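(* Let $X$ and $Y$ be two Banach spaces, let $1\le p<\infty$, and let $Z=X\oplus_p Y$. If $X$ or $Y$ has $BSCSP$, then $Z$ has $BSCSP$.
   Context: All Banach spaces are real and nontrivial. For a Banach space $E$, $B_E$ is the closed unit ball and $S_E$ the unit sphere. A slice of $B_E$ is a set $S(B_E,x^*,\alpha)=\{x\in B_E: x^*(x)>1-\alpha\}$ with $x^*\in S_{E^*}$ and $\alpha>0$. A convex combination of slices of $B_E$ is a set $\sum_{i=1}^n\lambda_i S_i$ (Minkowski sum), where each $S_i$ is a slice of $B_E$, $\lambda_i\ge 0$ and $\sum_{i=1}^n\lambda_i=1$. $E$ has the Ball Small Combination of Slice Property ($BSCSP$) if for every $\varepsilon>0$ there is a convex combination of slices of $B_E$ with diameter less than $\varepsilon$. $X\oplus_p Y$ is $X\times Y$ with norm $\|(x,y)\|=(\|x\|^p+\|y\|^p)^{1/p}$. *)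

theory Defs
  imports "HOL-Analysis.Analysis"
begin

(* The norm of the p-sum depends on the parameter p, so it cannot be the class norm of a type.
   All notions are therefore defined for a real vector space (a type) together with an explicit
   norm N; a Banach space given as a type of class banach is the case N = norm. *)

definition banach_norm :: "('v::real_vector \<Rightarrow> real) \<Rightarrow> bool" where
  "banach_norm N \<longleftrightarrow>
     (\<forall>x. 0 \<le> N x) \<and> (\<forall>x. N x = 0 \<longleftrightarrow> x = 0) \<and>
     (\<forall>c x. N (c *\<^sub>R x) = \<bar>c\<bar> * N x) \<and> (\<forall>x y. N (x + y) \<le> N x + N y) \<and>
     (\<forall>s :: nat \<Rightarrow> 'v.
        (\<forall>e>0. \<exists>M. \<forall>m\<ge>M. \<forall>n\<ge>M. N (s m - s n) < e) \<longrightarrow> (\<exists>l. (\<lambda>n. N (s n - l)) \<longlonglongrightarrow> 0))"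

definition dual_space :: "('v::real_vector \<Rightarrow> real) \<Rightarrow> ('v \<Rightarrow> real) set" where
  "dual_space N = {f. linear f \<and> (\<exists>K. \<forall>x. \<bar>f x\<bar> \<le> K * N x)}"

definition dual_norm :: "('v::real_vector \<Rightarrow> real) \<Rightarrow> ('v \<Rightarrow> real) \<Rightarrow> real" where
  "dual_norm N f = (SUP x\<in>{x. N x \<le> 1}. \<bar>f x\<bar>)"

definition slice :: "('v::real_vector \<Rightarrow> real) \<Rightarrow> ('v \<Rightarrow> real) \<Rightarrow> real \<Rightarrow> 'v set" where
  "slice N f \<alpha> = {x. N x \<le> 1 \<and> f x > 1 - \<alpha>}"

definition is_slice :: "('v::real_vector \<Rightarrow> real) \<Rightarrow> 'v set \<Rightarrow> bool" where
  "is_slice N S \<longleftrightarrow> (\<exists>f\<in>dual_space N. \<exists>\<alpha>>0. dual_norm N f = 1 \<and> S = slice N f \<alpha>)"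

(* The sum over i is the Minkowski sum of sets from HOL-Library.Set_Algebras. *)
definition convex_combination_of_slices :: "('v::real_vector \<Rightarrow> real) \<Rightarrow> 'v set \<Rightarrow> bool" where
  "convex_combination_of_slices N C \<longleftrightarrow>
     (\<exists>(n::nat) (c :: nat \<Rightarrow> real) (S :: nat \<Rightarrow> 'v set).
        (\<forall>i<n. is_slice N (S i) \<and> 0 \<le> c i) \<and> (\<Sum>i<n. c i) = 1 \<and>
        C = (\<Sum>i<n. (\<lambda>x. c i *\<^sub>R x) ` S i))"

(* Convex combinations of slices are bounded and nonempty, so the real supremum is meaningful. *)
definition norm_diameter :: "('v::real_vector \<Rightarrow> real) \<Rightarrow> 'v set \<Rightarrow> real" where
  "norm_diameter N C = (if C = {} then 0 else SUP (x, y)\<in>C \<times> C. N (x - y))"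

definition BSCSP :: "('v::real_vector \<Rightarrow> real) \<Rightarrow> bool" where
  "BSCSP N \<longleftrightarrow>
     (\<forall>\<epsilon>>0. \<exists>C. convex_combination_of_slices N C \<and> norm_diameter N C < \<epsilon>)"

definition p_sum_norm :: "real \<Rightarrow> 'a::real_normed_vector \<times> 'b::real_normed_vector \<Rightarrow> real" where
  "p_sum_norm p z = (norm (fst z) powr p + norm (snd z) powr p) powr (1 / p)"

lemma dual_space_norm: "dual_space norm = {f. bounded_linear f}"
  by (auto simp: dual_space_def bounded_linear_def bounded_linear_axioms_def mult.commute)

lemma dual_norm_norm:
  assumes "bounded_linear f"
  shows "dual_norm norm f = onorm f"
  unfolding dual_norm_def
proof (rule cSup_eq_non_empty)
  show "(\<lambda>x. \<bar>f x\<bar>) ` {x. norm x \<le> 1} \<noteq> {}"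
    by (auto intro!: exI[of _ 0])
next
  fix r assume "r \<in> (\<lambda>x. \<bar>f x\<bar>) ` {x. norm x \<le> 1}"
  then obtain x where x: "r = \<bar>f x\<bar>" "norm x \<le> 1" by auto
  have "\<bar>f x\<bar> \<le> onorm f * norm x" using onorm[OF assms, of x] by simp
  also have "\<dots> \<le> onorm f * 1" by (intro mult_left_mono x onorm_pos_le assms)
  finally show "r \<le> onorm f" using x by simp
next
  fix u assume u: "\<And>r. r \<in> (\<lambda>x. \<bar>f x\<bar>) ` {x. norm x \<le> 1} \<Longrightarrow> r \<le> u"
  have L: "linear f" using assms by (simp add: bounded_linear.linear)
  have u0: "0 \<le> u" using u[of "\<bar>f 0\<bar>"] linear_0[OF L] by force
  show "onorm f \<le> u"
  proof (rule onorm_bound[OF u0])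
    fix x show "norm (f x) \<le> u * norm x"
    proof (cases "x = 0")
      case True then show ?thesis using linear_0[OF L] by simp
    next
      case False
      have "\<bar>f (x /\<^sub>R norm x)\<bar> \<le> u" by (rule u) (use False in auto)
      then show ?thesis using False by (simp add: linear_scale[OF L] abs_mult field_simps)
    qed
  qed
qed

lemma norm_diameter_norm: "norm_diameter norm C = diameter C"
  by (simp add: norm_diameter_def diameter_def dist_norm)

lemma banach_norm_norm: "banach_norm (norm :: 'a::banach \<Rightarrow> real)"
  unfolding banach_norm_def
proof (intro conjI allI impI)
  fix s :: "nat \<Rightarrow> 'a"
  assume "\<forall>e>0. \<exists>M. \<forall>m\<ge>M. \<forall>n\<ge>M. norm (s m - s n) < e"
  then have "Cauchy s" by (simp add: Cauchy_def dist_norm)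
  then obtain l where "s \<longlonglongrightarrow> l" using Cauchy_convergent convergent_def by blast
  then show "\<exists>l. (\<lambda>n. norm (s n - l)) \<longlonglongrightarrow> 0"
    using LIM_zero tendsto_norm_zero by blast
qed (auto simp: norm_triangle_ineq)

lemma p_sum_norm_powr:
  assumes "1 \<le> p"
  shows "p_sum_norm p z powr p = norm (fst z) powr p + norm (snd z) powr p"
  using assms by (simp add: p_sum_norm_def powr_powr add_nonneg_nonneg)

lemma powr_convex_nonneg:
  fixes a b t p :: real
  assumes "1 \<le> p" "0 \<le> a" "0 \<le> b" "0 \<le> t" "t \<le> 1"
  shows "((1 - t) * a + t * b) powr p \<le> (1 - t) * a powr p + t * b powr p"
proof -
  have small: "(s * c) powr p \<le> s * c powr p" if "0 \<le> s" "s \<le> 1" "0 \<le> c" for s c :: real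
  proof -
    have "s powr p \<le> s" using powr_mono'[of 1 p s] that assms(1) by simp
    then show ?thesis using that by (simp add: powr_mult mult_right_mono)
  qed
  consider "a = 0" | "b = 0" | "0 < a" "0 < b" using assms by linarith
  then show ?thesis
  proof cases
    case 3
    then show ?thesis
      using convex_onD[OF powr_convex[OF assms(1)], of t a b] assms by simp
  qed (use small[of t b] small[of "1 - t" a] assms in simp_all)
qed

lemma banach_norm_p_sum_norm:
  assumes p: "1 \<le> p"
  shows "banach_norm (p_sum_norm p :: 'a::banach \<times> 'b::banach \<Rightarrow> real)"
proof -
  let ?N = "p_sum_norm p :: 'a \<times> 'b \<Rightarrow> real"
  have nonneg: "0 \<le> ?N z" for z by (simp add: p_sum_norm_def)
  have zero: "?N z = 0 \<longleftrightarrow> z = 0" for z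
    using p by (auto simp: p_sum_norm_def prod_eq_iff add_nonneg_eq_0_iff)
  have scale: "?N (c *\<^sub>R z) = \<bar>c\<bar> * ?N z" for c z
  proof -
    have "?N (c *\<^sub>R z) = (\<bar>c\<bar> powr p * (norm (fst z) powr p + norm (snd z) powr p)) powr (1/p)"
      by (simp add: p_sum_norm_def powr_mult distrib_left)
    also have "\<dots> = \<bar>c\<bar> * ?N z"
      using p by (simp add: p_sum_norm_def powr_mult powr_powr)
    finally show ?thesis .
  qed
  have ball: "?N z \<le> 1 \<longleftrightarrow> norm (fst z) powr p + norm (snd z) powr p \<le> 1" for z
    using powr_mono2[of p "?N z" 1] powr_less_mono2[of p 1 "?N z"] p p_sum_norm_powr[OF p, of z]
      nonneg[of z]
    by (cases "?N z \<le> 1") auto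
  have conv: "?N ((1 - t) *\<^sub>R u + t *\<^sub>R v) \<le> 1"
    if "?N u \<le> 1" "?N v \<le> 1" "0 \<le> t" "t \<le> 1" for u v t
  proof -
    have comp: "norm ((1 - t) *\<^sub>R x + t *\<^sub>R y) powr p
        \<le> (1 - t) * norm x powr p + t * norm y powr p"
      for x y :: "'c::real_normed_vector"
    proof -
      have "norm ((1 - t) *\<^sub>R x + t *\<^sub>R y) powr p \<le> ((1 - t) * norm x + t * norm y) powr p"
        using norm_triangle_ineq[of "(1 - t) *\<^sub>R x" "t *\<^sub>R y"] that p
        by (intro powr_mono2) auto
      also have "\<dots> \<le> (1 - t) * norm x powr p + t * norm y powr p"
        using powr_convex_nonneg[OF p, of "norm x" "norm y" t] that by simp
      finally show ?thesis .
    qed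
    have "norm (fst ((1 - t) *\<^sub>R u + t *\<^sub>R v)) powr p + norm (snd ((1 - t) *\<^sub>R u + t *\<^sub>R v)) powr p
       \<le> (1 - t) * (norm (fst u) powr p + norm (snd u) powr p)
          + t * (norm (fst v) powr p + norm (snd v) powr p)"
      using comp[of "fst u" "fst v"] comp[of "snd u" "snd v"] by (simp add: algebra_simps)
    also have "\<dots> \<le> (1 - t) * 1 + t * 1"
      using that unfolding ball by (intro add_mono mult_left_mono) auto
    finally show ?thesis unfolding ball by simp
  qed
  have tri: "?N (z + w) \<le> ?N z + ?N w" for z w
  proof (cases "z = 0 \<or> w = 0")
    case True
    then show ?thesis using nonneg[of z] nonneg[of w] by auto
  next
    case False
    define A B where "A = ?N z" and "B = ?N w"
    have AB: "A > 0" "B > 0" using False zero nonneg by (auto simp: A_def B_def less_le)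
    define t where "t = B / (A + B)"
    have t: "0 \<le> t" "t \<le> 1" "1 - t = A / (A + B)" using AB by (auto simp: t_def field_simps)
    have "?N ((1 - t) *\<^sub>R (inverse A *\<^sub>R z) + t *\<^sub>R (inverse B *\<^sub>R w)) \<le> 1"
      using AB t by (intro conv) (auto simp: scale A_def B_def)
    also have "(1 - t) *\<^sub>R (inverse A *\<^sub>R z) + t *\<^sub>R (inverse B *\<^sub>R w) = inverse (A + B) *\<^sub>R (z + w)"
    proof -
      have "(1 - t) * inverse A = inverse (A + B)" "t * inverse B = inverse (A + B)"
        unfolding t(3) using AB by (simp_all add: t_def field_simps)
      then show ?thesis by (simp add: scaleR_add_right)
    qed
    finally have "?N (z + w) / (A + B) \<le> 1"
      unfolding scale using AB by (simp add: divide_inverse mult.commute)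
    then show ?thesis using AB by (simp add: A_def B_def divide_le_eq)
  qed
  have comp_le: "norm (fst z) \<le> ?N z" "norm (snd z) \<le> ?N z" for z
  proof -
    have "norm (fst z) = (norm (fst z) powr p) powr (1/p)"
      using p by (simp add: powr_powr)
    also have "\<dots> \<le> ?N z" unfolding p_sum_norm_def using p by (intro powr_mono2) auto
    finally show "norm (fst z) \<le> ?N z" .
    have "norm (snd z) = (norm (snd z) powr p) powr (1/p)"
      using p by (simp add: powr_powr)
    also have "\<dots> \<le> ?N z" unfolding p_sum_norm_def using p by (intro powr_mono2) auto
    finally show "norm (snd z) \<le> ?N z" .
  qed
  have le_sum: "?N z \<le> norm (fst z) + norm (snd z)" for z
    using tri[of "(fst z, 0)" "(0, snd z)"] p by (simp add: p_sum_norm_def powr_powr)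
  have complete: "\<exists>l. (\<lambda>n. ?N (s n - l)) \<longlonglongrightarrow> 0"
    if C: "\<forall>e>0. \<exists>M. \<forall>m\<ge>M. \<forall>n\<ge>M. ?N (s m - s n) < e" for s :: "nat \<Rightarrow> 'a \<times> 'b"
  proof -
    have "Cauchy (\<lambda>n. fst (s n))" "Cauchy (\<lambda>n. snd (s n))"
      unfolding Cauchy_def dist_norm fst_diff[symmetric] snd_diff[symmetric]
      using C comp_le by (meson le_less_trans)+
    then obtain a b where ab: "(\<lambda>n. fst (s n)) \<longlonglongrightarrow> a" "(\<lambda>n. snd (s n)) \<longlonglongrightarrow> b"
      using Cauchy_convergent convergent_def by metis
    then have "(\<lambda>n. norm (fst (s n) - a) + norm (snd (s n) - b)) \<longlonglongrightarrow> 0"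
      by (intro tendsto_add_zero tendsto_norm_zero LIM_zero)
    then have "(\<lambda>n. ?N (s n - (a, b))) \<longlonglongrightarrow> 0"
    proof (rule Lim_null_comparison[rotated])
      show "\<forall>\<^sub>F n in sequentially.
          norm (?N (s n - (a, b))) \<le> norm (fst (s n) - a) + norm (snd (s n) - b)"
        using nonneg le_sum[of "s n - (a, b)" for n] by simp
    qed
    then show ?thesis by blast
  qed
  show ?thesis
    unfolding banach_norm_def using nonneg zero scale tri complete by blast
qed

end

theory Submission
  imports Defs
begin

text \<open>If \<open>f\<close> is a norm-one functional on \<open>X\<close>, then \<open>(x, y) \<mapsto> f x\<close> is a norm-one functional
  on \<open>Z\<close>. A point \<open>(x, y)\<close> of a thin slice that it defines has \<open>\<parallel>x\<parallel>\<close> close to \<open>1\<close>, and hence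
  \<open>\<parallel>y\<parallel>\<close> close to \<open>0\<close>. So, lifting the slices of a convex combination \<open>C\<close> in \<open>X\<close> and thinning
  them, one gets a convex combination of slices of \<open>B\<^sub>Z\<close> inside \<open>C \<times> \<eta> B\<^sub>Y\<close>.\<close>

lemma slice_subset_unit_ball: "is_slice N S \<Longrightarrow> x \<in> S \<Longrightarrow> N x \<le> 1"
  by (auto simp: is_slice_def slice_def)

text \<open>Used twice: with \<open>r\<close> = 1 to bound a convex combination of slices, and with
  a small \<open>r\<close> to control the second coordinate of a lifted combination.\<close>

lemma norm_convex_combination_le:
  fixes x :: "nat \<Rightarrow> 'v::real_normed_vector"
  assumes "\<And>i. i < n \<Longrightarrow> 0 \<le> c i" "(\<Sum>i<n. c i) = 1" "\<And>i. i < n \<Longrightarrow> norm (x i) \<le> r"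
  shows "norm (\<Sum>i<n. c i *\<^sub>R x i) \<le> r"
proof -
  have "norm (\<Sum>i<n. c i *\<^sub>R x i) \<le> (\<Sum>i<n. c i * r)"
    by (rule sum_norm_le) (use assms in \<open>auto intro: mult_left_mono\<close>)
  also have "\<dots> = r" using assms(2) by (simp flip: sum_distrib_right)
  finally show ?thesis .
qed

text \<open>\<open>diameter\<close> is a supremum of distances, so it dominates each distance only
  on a bounded set. Slices lie in the unit ball, which is convex.\<close>

lemma convex_combination_of_slices_bounded:
  fixes C :: "'v::real_normed_vector set"
  assumes "convex_combination_of_slices norm C"
  shows "bounded C"
proof -
  from assms obtain n :: nat and c and S :: "nat \<Rightarrow> 'v set" where
    S: "\<And>i. i < n \<Longrightarrow> is_slice norm (S i)" and c: "\<And>i. i < n \<Longrightarrow> 0 \<le> c i" "(\<Sum>i<n. c i) = 1"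
    and C: "C = (\<Sum>i<n. (\<lambda>x. c i *\<^sub>R x) ` S i)"
    unfolding convex_combination_of_slices_def by blast
  have "norm x \<le> 1" if x: "x \<in> C" for x
  proof -
    obtain s where s: "x = sum s {..<n}" "\<And>i. i < n \<Longrightarrow> s i \<in> (\<lambda>x. c i *\<^sub>R x) ` S i"
      using x unfolding C set_sum_alt[OF finite_lessThan] by auto
    then have "\<forall>i\<in>{..<n}. \<exists>y. y \<in> S i \<and> s i = c i *\<^sub>R y" by blast
    then obtain y where y: "\<And>i. i < n \<Longrightarrow> y i \<in> S i \<and> s i = c i *\<^sub>R y i"
      by (metis lessThan_iff)
    then have "x = (\<Sum>i<n. c i *\<^sub>R y i)" using s(1) by simp
    then show ?thesis
      using norm_convex_combination_le[OF c, of y 1] y S slice_subset_unit_ball by blast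
  qed
  then show ?thesis by (auto simp: bounded_iff)
qed

text \<open>The slice is pulled back along \<open>P\<close>, which stands for a coordinate
  projection of the p-sum. Mapping the unit ball onto the unit ball is what preserves the norm of
  the functional.\<close>

lemma is_slice_lift:
  fixes N :: "'v::real_vector \<Rightarrow> real" and P :: "'v \<Rightarrow> 'e::real_normed_vector"
  assumes P: "linear P" "\<And>z. norm (P z) \<le> N z" "P ` {z. N z \<le> 1} = {x. norm x \<le> 1}"
    and S: "is_slice norm S" and \<delta>: "0 < \<delta>"
  obtains T where "is_slice N T" "\<And>z. z \<in> T \<Longrightarrow> N z \<le> 1 \<and> P z \<in> S \<and> norm (P z) > 1 - \<delta>"
proof -
  from S obtain f \<alpha> where f: "f \<in> dual_space norm" "dual_norm norm f = 1" "0 < \<alpha>"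
    "S = slice norm f \<alpha>" unfolding is_slice_def by blast
  have bl: "bounded_linear f" using f(1) by (simp add: dual_space_norm)
  have f_le: "f x \<le> norm x" for x
    using onorm[OF bl, of x] f(2) dual_norm_norm[OF bl] by simp
  \<comment> \<open>Width at most \<alpha> puts \<open>P z\<close> in \<open>S\<close>. Width at
    most \<delta> makes \<open>norm (P z)\<close> large, since a norm-one functional satisfies
    \<open>f (P z) \<le> norm (P z)\<close>.\<close>
  define T where "T = slice N (f \<circ> P) (min \<alpha> \<delta>)"
  have "\<bar>(f \<circ> P) z\<bar> \<le> 1 * N z" for z
    using onorm[OF bl, of "P z"] f(2) dual_norm_norm[OF bl] P(2)[of z] by simp
  then have "f \<circ> P \<in> dual_space N"
    unfolding dual_space_def
    using linear_compose[OF P(1) bounded_linear.linear[OF bl]] by blast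
  \<comment> \<open>Both suprema run over the same set of values, because \<open>P\<close> maps one
    unit ball onto the other.\<close>
  moreover have "dual_norm N (f \<circ> P) = dual_norm norm f"
    unfolding dual_norm_def P(3)[symmetric] by (simp add: image_image)
  ultimately have "is_slice N T"
    unfolding is_slice_def T_def using f(2,3) \<delta>
    by (intro bexI[of _ "f \<circ> P"] exI[of _ "min \<alpha> \<delta>"]) auto
  moreover have "N z \<le> 1 \<and> P z \<in> S \<and> norm (P z) > 1 - \<delta>" if "z \<in> T" for z
    using that P(2)[of z] f_le[of "P z"] f(4) by (auto simp: T_def slice_def)
  ultimately show ?thesis using that by blast
qed

text \<open>Stated for abstract maps \<open>P\<close> and \<open>R\<close> so that one argument
  serves both factors, with \<open>fst\<close> and \<open>snd\<close> exchanging roles. The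
  hypothesis \<open>thin\<close> carries the geometry: a point of the ball with nearly maximal
  \<open>P\<close>-part has a small \<open>R\<close>-part.\<close>

lemma BSCSP_lift:
  fixes N :: "'v::real_vector \<Rightarrow> real" and P :: "'v \<Rightarrow> 'e::real_normed_vector"
    and R :: "'v \<Rightarrow> 'f::real_normed_vector"
  assumes P: "linear P" "\<And>z. norm (P z) \<le> N z" "P ` {z. N z \<le> 1} = {x. norm x \<le> 1}"
    and R: "linear R" "\<And>z. N z \<le> norm (P z) + norm (R z)"
    and thin: "\<And>\<eta>. 0 < \<eta> \<Longrightarrow> \<exists>\<delta>>0. \<forall>z. N z \<le> 1 \<longrightarrow> norm (P z) > 1 - \<delta> \<longrightarrow> norm (R z) \<le> \<eta>"
    and E: "BSCSP (norm :: 'e \<Rightarrow> real)"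
  shows "BSCSP N"
  unfolding BSCSP_def
proof (intro allI impI)
  fix \<epsilon> :: real assume \<epsilon>: "0 < \<epsilon>"
  from E \<epsilon> obtain C :: "'e set" where C: "convex_combination_of_slices norm C" "diameter C < \<epsilon>"
    unfolding BSCSP_def norm_diameter_norm by blast
  from C(1) obtain n :: nat and c and S :: "nat \<Rightarrow> 'e set" where
    S: "\<And>i. i < n \<Longrightarrow> is_slice norm (S i)" and c: "\<And>i. i < n \<Longrightarrow> 0 \<le> c i" "(\<Sum>i<n. c i) = 1"
    and C_eq: "C = (\<Sum>i<n. (\<lambda>x. c i *\<^sub>R x) ` S i)"
    unfolding convex_combination_of_slices_def by blast
  \<comment> \<open>With this value \<open>diameter C + 2 * \<eta>\<close> is the midpoint of
    \<open>diameter C\<close> and \<epsilon>, hence still below \<epsilon>.\<close>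
  define \<eta> where "\<eta> = (\<epsilon> - diameter C) / 4"
  have \<eta>: "0 < \<eta>" using C(2) by (simp add: \<eta>_def)
  obtain \<delta> where \<delta>: "0 < \<delta>" "\<And>z. N z \<le> 1 \<Longrightarrow> norm (P z) > 1 - \<delta> \<Longrightarrow> norm (R z) \<le> \<eta>"
    using thin[OF \<eta>] by blast
  have "\<forall>i\<in>{..<n}. \<exists>T. is_slice N T \<and> (\<forall>z\<in>T. P z \<in> S i \<and> norm (R z) \<le> \<eta>)"
    using is_slice_lift[OF P S \<delta>(1)] \<delta>(2) by (metis lessThan_iff)
  then obtain T where T: "\<And>i. i < n \<Longrightarrow> is_slice N (T i)"
    "\<And>i z. i < n \<Longrightarrow> z \<in> T i \<Longrightarrow> P z \<in> S i \<and> norm (R z) \<le> \<eta>"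
    by (metis lessThan_iff)
  \<comment> \<open>The weights are those of \<open>C\<close>, so the linear map \<open>P\<close>
    sends \<open>D\<close> into \<open>C\<close>, while \<open>R\<close> sends it into the ball of
    radius \<eta>.\<close>
  define D where "D = (\<Sum>i<n. (\<lambda>x. c i *\<^sub>R x) ` T i)"
  have D: "P u \<in> C \<and> norm (R u) \<le> \<eta>" if u: "u \<in> D" for u
  proof -
    obtain s where s: "u = sum s {..<n}" "\<And>i. i < n \<Longrightarrow> s i \<in> (\<lambda>x. c i *\<^sub>R x) ` T i"
      using u unfolding D_def set_sum_alt[OF finite_lessThan] by auto
    then have "\<forall>i\<in>{..<n}. \<exists>z. z \<in> T i \<and> s i = c i *\<^sub>R z" by blast
    then obtain z where z: "\<And>i. i < n \<Longrightarrow> z i \<in> T i \<and> s i = c i *\<^sub>R z i"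
      by (metis lessThan_iff)
    then have u_eq: "u = (\<Sum>i<n. c i *\<^sub>R z i)" using s(1) by simp
    have "P u = (\<Sum>i<n. c i *\<^sub>R P (z i))" "R u = (\<Sum>i<n. c i *\<^sub>R R (z i))"
      by (simp_all add: u_eq linear_sum[OF P(1)] linear_scale[OF P(1)]
          linear_sum[OF R(1)] linear_scale[OF R(1)])
    moreover have "(\<Sum>i<n. c i *\<^sub>R P (z i)) \<in> C"
      unfolding C_eq set_sum_alt[OF finite_lessThan] using z T(2) by blast
    moreover have "norm (\<Sum>i<n. c i *\<^sub>R R (z i)) \<le> \<eta>"
      using norm_convex_combination_le[OF c, of "\<lambda>i. R (z i)" \<eta>] z T(2) by blast
    ultimately show ?thesis by simp
  qed
  have dist: "N (u - v) \<le> diameter C + 2 * \<eta>" if "u \<in> D" "v \<in> D" for u v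
  proof -
    have "norm (P u - P v) \<le> diameter C"
      using diameter_bounded_bound[OF convex_combination_of_slices_bounded[OF C(1)], of "P u" "P v"]
        D that by (simp add: dist_norm)
    moreover have "norm (R u - R v) \<le> 2 * \<eta>"
      using norm_triangle_ineq4[of "R u" "R v"] D[OF that(1)] D[OF that(2)] by linarith
    ultimately show ?thesis
      using R(2)[of "u - v"] by (simp add: linear_diff[OF P(1)] linear_diff[OF R(1)])
  qed
  have "norm_diameter N D < \<epsilon>"
  \<comment> \<open>The supremum bound requires a nonempty set; the empty set has diameter 0 by
    convention.\<close>
  proof (cases "D = {}")
    case False
    then have "norm_diameter N D \<le> diameter C + 2 * \<eta>"
      unfolding norm_diameter_def using dist by (auto intro!: cSUP_least)
    also have "\<dots> < \<epsilon>" using C(2) by (simp add: \<eta>_def field_simps)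
    finally show ?thesis .
  qed (simp add: norm_diameter_def \<epsilon>)
  moreover have "convex_combination_of_slices N D"
    unfolding convex_combination_of_slices_def D_def using T(1) c by blast
  ultimately show "\<exists>C. convex_combination_of_slices N C \<and> norm_diameter N C < \<epsilon>" by blast
qed

text \<open>If \<open>a powr p\<close> exceeds \<open>1 - \<eta> powr p\<close>, then less than
  \<open>\<eta> powr p\<close> is left for \<open>b powr p\<close>. The value of \<delta> comes from
  solving the first inequality for \<open>a\<close>.\<close>

lemma powr_sum_thin:
  fixes p \<eta> :: real
  assumes p: "1 \<le> p" and \<eta>: "0 < \<eta>"
  shows "\<exists>\<delta>>0. \<forall>a b. 0 \<le> b \<longrightarrow> a powr p + b powr p \<le> 1 \<longrightarrow> a > 1 - \<delta> \<longrightarrow> b \<le> \<eta>"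
proof -
  \<comment> \<open>The maximum keeps the base of the p-th root nonnegative when \<eta> is greater
    than 1.\<close>
  define c where "c = max 0 (1 - \<eta> powr p)"
  have c: "0 \<le> c" "c < 1" using \<eta> by (auto simp: c_def)
  show ?thesis
  proof (intro exI[of _ "1 - c powr (1 / p)"] conjI allI impI)
    show "0 < 1 - c powr (1 / p)"
      using powr_less_mono2[of "1 / p" c 1] c p by simp
    fix a b :: real
    assume b: "0 \<le> b" and le: "a powr p + b powr p \<le> 1" and a: "a > 1 - (1 - c powr (1 / p))"
    have "c = (c powr (1 / p)) powr p" using c p by (simp add: powr_powr)
    also have "\<dots> < a powr p" using a p by (intro powr_less_mono2) auto
    finally have "b powr p < \<eta> powr p" using le by (simp add: c_def)
    \<comment> \<open>By contraposition: \<eta> < b would give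
      \<open>\<eta> powr p \<le> b powr p\<close>.\<close>
    then show "b \<le> \<eta>" using powr_mono2[of p \<eta> b] p \<eta> by linarith
  qed
qed

lemma p_sum_norm_Pair_0:
  assumes "1 \<le> p"
  shows "p_sum_norm p (x, 0) = norm x" "p_sum_norm p (0, y) = norm y"
  using assms by (simp_all add: p_sum_norm_def powr_powr)

lemma norm_fst_snd_le_p_sum_norm:
  assumes "1 \<le> p"
  shows "norm (fst z) \<le> p_sum_norm p z" "norm (snd z) \<le> p_sum_norm p z"
proof -
  have "norm (fst z) = (norm (fst z) powr p) powr (1 / p)"
    "norm (snd z) = (norm (snd z) powr p) powr (1 / p)"
    using assms by (simp_all add: powr_powr)
  moreover have "(norm (fst z) powr p) powr (1 / p) \<le> p_sum_norm p z"
    "(norm (snd z) powr p) powr (1 / p) \<le> p_sum_norm p z"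
    unfolding p_sum_norm_def using assms by (auto intro!: powr_mono2)
  ultimately show "norm (fst z) \<le> p_sum_norm p z" "norm (snd z) \<le> p_sum_norm p z" by simp_all
qed

text \<open>This is the triangle inequality of the p-sum norm for the splitting of \<open>z\<close>
  into its two coordinate vectors.\<close>

lemma p_sum_norm_le_sum:
  fixes z :: "'a::banach \<times> 'b::banach"
  assumes "1 \<le> p"
  shows "p_sum_norm p z \<le> norm (fst z) + norm (snd z)"
proof -
  let ?u = "(fst z, 0) :: 'a \<times> 'b" and ?v = "(0, snd z) :: 'a \<times> 'b"
  have "p_sum_norm p (?u + ?v) \<le> p_sum_norm p ?u + p_sum_norm p ?v"
    using banach_norm_p_sum_norm[OF assms, where 'a = 'a and 'b = 'b]
    unfolding banach_norm_def by blast
  then show ?thesis by (simp add: p_sum_norm_Pair_0[OF assms])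
qed

lemma p_sum_norm_le_1:
  assumes "1 \<le> p" "p_sum_norm p z \<le> 1"
  shows "norm (fst z) powr p + norm (snd z) powr p \<le> 1"
  using powr_mono2[of p "p_sum_norm p z" 1] p_sum_norm_powr[OF assms(1), of z] assms
  by (simp add: p_sum_norm_def)

theorem proposition2p12:
  fixes p :: real
  assumes "\<exists>x :: 'a::banach. x \<noteq> 0"
    and "\<exists>y :: 'b::banach. y \<noteq> 0"
    and "1 \<le> p"
    and "BSCSP (norm :: 'a \<Rightarrow> real) \<or> BSCSP (norm :: 'b \<Rightarrow> real)"
  shows "BSCSP (p_sum_norm p :: 'a \<times> 'b \<Rightarrow> real)"
proof -
  let ?N = "p_sum_norm p :: 'a \<times> 'b \<Rightarrow> real"
  note p = \<open>1 \<le> p\<close>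
  note le = norm_fst_snd_le_p_sum_norm[OF p]
  \<comment> \<open>The projection does not increase the norm, and \<open>(x, 0)\<close> is a
    preimage of \<open>x\<close> with the same norm.\<close>
  have ball_fst: "fst ` {z. ?N z \<le> 1} = {x. norm x \<le> 1}"
  proof (intro subset_antisym subsetI)
    fix x :: 'a assume "x \<in> {x. norm x \<le> 1}"
    then show "x \<in> fst ` {z. ?N z \<le> 1}"
      by (intro image_eqI[of _ _ "(x, 0)"]) (auto simp: p_sum_norm_Pair_0[OF p])
  qed (use le(1) order_trans in blast)
  have ball_snd: "snd ` {z. ?N z \<le> 1} = {y. norm y \<le> 1}"
  proof (intro subset_antisym subsetI)
    fix y :: 'b assume "y \<in> {y. norm y \<le> 1}"
    then show "y \<in> snd ` {z. ?N z \<le> 1}"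
      by (intro image_eqI[of _ _ "(0, y)"]) (auto simp: p_sum_norm_Pair_0[OF p])
  qed (use le(2) order_trans in blast)
  \<comment> \<open>The constraint is symmetric in the two coordinates, so a single \<delta> serves
    both directions.\<close>
  have thin: "\<exists>\<delta>>0. \<forall>z. ?N z \<le> 1 \<longrightarrow>
      (norm (fst z) > 1 - \<delta> \<longrightarrow> norm (snd z) \<le> \<eta>) \<and> (norm (snd z) > 1 - \<delta> \<longrightarrow> norm (fst z) \<le> \<eta>)"
    if \<eta>: "0 < \<eta>" for \<eta>
  proof -
    obtain \<delta> where \<delta>: "0 < \<delta>"
      "\<And>a b. 0 \<le> b \<Longrightarrow> a powr p + b powr p \<le> 1 \<Longrightarrow> a > 1 - \<delta> \<Longrightarrow> b \<le> \<eta>"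
      using powr_sum_thin[OF p \<eta>] by blast
    show ?thesis
    proof (intro exI[of _ \<delta>] conjI allI impI \<delta>(1))
      fix z :: "'a \<times> 'b" assume "?N z \<le> 1"
      then have le1: "norm (fst z) powr p + norm (snd z) powr p \<le> 1"
        by (rule p_sum_norm_le_1[OF p])
      show "norm (snd z) \<le> \<eta>" if "norm (fst z) > 1 - \<delta>"
        by (rule \<delta>(2)[OF _ le1 that]) simp
      show "norm (fst z) \<le> \<eta>" if "norm (snd z) > 1 - \<delta>"
        by (rule \<delta>(2)[OF _ _ that]) (use le1 in auto)
    qed
  qed
  from assms(4) show ?thesis
  proof
    assume "BSCSP (norm :: 'a \<Rightarrow> real)"
    then show ?thesis
      using BSCSP_lift[OF linear_fst le(1) ball_fst linear_snd p_sum_norm_le_sum[OF p]] thin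
      by meson
  next
    \<comment> \<open>For the second factor \<open>snd\<close> plays the role of \<open>P\<close>,
      so the summands are needed in the opposite order.\<close>
    have "?N z \<le> norm (snd z) + norm (fst z)" for z
      using p_sum_norm_le_sum[OF p, of z] by simp
    moreover assume "BSCSP (norm :: 'b \<Rightarrow> real)"
    ultimately show ?thesis
      using BSCSP_lift[OF linear_snd le(2) ball_snd linear_fst] thin by meson
  qed
qed

end
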